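(* Let $n$ be a positive integer and fix $a\in C_{2n}^\times$ (regarded as an integer with $0\le a\le 2n-1$, which is odd). Write $a=2k+1$ with $k$ a nonnegative integer, let $g=\gcd(k,n)$ and let $\tilde a=a-\lfloor\frac{a}{n}\rfloor n$. Then there is a quandle isomorphism $Q(C_{2n},a)\cong Q(D_n,\varphi_{\tilde a,g})$.
   Context: $C_m=\{0,1,\ldots,m-1\}$ is the cyclic group with addition modulo $m$, and $C_m^\times=\{a\in C_m:\gcd(a,m)=1\}$; an element $a\in C_m^\times$ is identified with the automorphism $x\mapsto ax$ of $C_m$. $D_n=\{\tau^\epsilon\sigma^i:\epsilon\in\{0,1\},\,0\le i\le n-1\}$ is the dihedral group of order $2n$, with relations $\tau^2=\sigma^n=e$, $\sigma\tau=\tau\sigma^{-1}$. For $c\in C_n^\times$, $d\in C_n$ (integers are read modulo $n$), $\varphi_{c,d}:D_n\to D_n$ is the group automorphism $\varphi_{c,d}(\tau^\epsilon\sigma^i)=\tau^\epsilon\sigma^{ci+\epsilon d}$. The convention $\gcd(0,n)=n$ is used. For a finite group $G$ and a group automorphism $\psi$, the generalized Alexander quandle $Q(G,\psi)$ is the set $G$ equipped with the maps $s_x:G\to G$, $s_x(y)=x\psi(x^{-1}y)$, for $x\in G$ (for $G=C_{2n}$ and $\psi=a$: $s_x(y)=x+a(y-x)$). A quandle isomorphism from $(Q,s)$ to $(Q',s')$ is a bijection $f:Q\to Q'$ with $f\circ s_x=s'_{f(x)}\circ f$ for all $x\in Q$. *)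

theory Defs
  imports Complex_Main "HOL-Algebra.Elementary_Groups"
begin

text \<open>
  The group \<open>C_m\<close> is the library's \<^const>\<open>integer_mod_group\<close>, with carrier \<open>{0..<int m}\<close> for \<open>m > 0\<close>.
\<close>

definition cyclic_units :: "nat \<Rightarrow> int set" where
  "cyclic_units m = {a \<in> carrier (integer_mod_group m). coprime a (int m)}"

definition cyclic_aut :: "nat \<Rightarrow> int \<Rightarrow> int \<Rightarrow> int" where
  "cyclic_aut m a x = (a * x) mod int m"

text \<open>
  The pair \<open>(\<epsilon>, i)\<close> stands for \<open>\<tau>\<^sup>\<epsilon> \<sigma>\<^sup>i\<close>; the product comes from
  \<open>\<sigma>\<^sup>i \<tau>\<^sup>\<delta> = \<tau>\<^sup>\<delta> \<sigma>\<^sup>j\<close> with \<open>j = (-1)\<^sup>\<delta> i\<close>.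
\<close>

definition dihedral_group :: "nat \<Rightarrow> (nat \<times> int) monoid" where
  "dihedral_group n =
     \<lparr>carrier = {0, 1} \<times> carrier (integer_mod_group n),
      monoid.mult = (\<lambda>(\<epsilon>, i) (\<delta>, j). ((\<epsilon> + \<delta>) mod 2, ((-1) ^ \<delta> * i + j) mod int n)),
      one = (0, 0)\<rparr>"

definition dihedral_aut :: "nat \<Rightarrow> int \<Rightarrow> int \<Rightarrow> nat \<times> int \<Rightarrow> nat \<times> int" where
  "dihedral_aut n c d = (\<lambda>(\<epsilon>, i). (\<epsilon>, (c * i + int \<epsilon> * d) mod int n))"

record 'a quandle_struct = "'a partial_object" +
  qsym :: "'a \<Rightarrow> 'a \<Rightarrow> 'a"

definition gen_alexander_quandle :: "('a, 'b) monoid_scheme \<Rightarrow> ('a \<Rightarrow> 'a) \<Rightarrow> 'a quandle_struct" where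
  "gen_alexander_quandle G \<psi> =
     \<lparr>carrier = carrier G, qsym = (\<lambda>x y. x \<otimes>\<^bsub>G\<^esub> \<psi> (inv\<^bsub>G\<^esub> x \<otimes>\<^bsub>G\<^esub> y))\<rparr>"

definition quandle_iso :: "'a quandle_struct \<Rightarrow> 'b quandle_struct \<Rightarrow> ('a \<Rightarrow> 'b) set" where
  "quandle_iso Q Q' =
     {f. bij_betw f (carrier Q) (carrier Q') \<and>
         (\<forall>x \<in> carrier Q. \<forall>y \<in> carrier Q. f (qsym Q x y) = qsym Q' (f x) (f y))}"

definition quandle_isomorphic :: "'a quandle_struct \<Rightarrow> 'b quandle_struct \<Rightarrow> bool" where
  "quandle_isomorphic Q Q' \<longleftrightarrow> quandle_iso Q Q' \<noteq> {}"

lemma mod_self_in_carrier [simp]: "x mod int n \<in> carrier (integer_mod_group n)"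
  by (simp add: carrier_integer_mod_group)

lemma mod_carrier_integer_mod_group [simp]:
  "x \<in> carrier (integer_mod_group n) \<Longrightarrow> x mod int n = x"
  by (auto simp: carrier_integer_mod_group split: if_splits)

lemma group_dihedral_group: "group (dihedral_group n)"
proof (rule groupI)
  fix x y z
  assume "x \<in> carrier (dihedral_group n)" "y \<in> carrier (dihedral_group n)"
    "z \<in> carrier (dihedral_group n)"
  then show "x \<otimes>\<^bsub>dihedral_group n\<^esub> y \<otimes>\<^bsub>dihedral_group n\<^esub> z =
      x \<otimes>\<^bsub>dihedral_group n\<^esub> (y \<otimes>\<^bsub>dihedral_group n\<^esub> z)"
    by (auto simp: dihedral_group_def mod_simps algebra_simps)
next
  fix x
  assume "x \<in> carrier (dihedral_group n)"
  then obtain e i where x: "x = (e, i)" "e \<in> {0, 1}" "i \<in> carrier (integer_mod_group n)"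
    by (auto simp: dihedral_group_def)
  have "(e, (if e = 0 then - i else i) mod int n) \<otimes>\<^bsub>dihedral_group n\<^esub> x = \<one>\<^bsub>dihedral_group n\<^esub>"
    using x by (auto simp: dihedral_group_def mod_simps)
  moreover have "(e, (if e = 0 then - i else i) mod int n) \<in> carrier (dihedral_group n)"
    using x by (auto simp: dihedral_group_def)
  ultimately show "\<exists>y \<in> carrier (dihedral_group n). y \<otimes>\<^bsub>dihedral_group n\<^esub> x = \<one>\<^bsub>dihedral_group n\<^esub>"
    by blast
qed (auto simp: dihedral_group_def)

lemma inverse_mod_exists:
  assumes "coprime a (int m)"
  obtains b where "\<And>x. (a * b * x) mod int m = x mod int m"
proof -
  obtain b v where "b * a + v * int m = 1"
    using bezout_int[of a "int m"] assms by auto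
  then have ab: "a * b = 1 + (- v) * int m"
    by (simp add: algebra_simps)
  have "a * b * x = x + (- v * x) * int m" for x
    unfolding ab by (simp add: algebra_simps)
  then have "(a * b * x) mod int m = x mod int m" for x
    by (metis mod_mult_self1)
  then show thesis
    by (rule that)
qed

lemma mod_add_mult_right_eq: "(d + c * (x mod m)) mod m = (d + c * x) mod (m :: int)"
  by (metis mod_add_right_eq mod_mult_right_eq)

lemma cyclic_aut_iso:
  assumes "coprime a (int m)"
  shows "cyclic_aut m a \<in> iso (integer_mod_group m) (integer_mod_group m)"
proof (rule isoI)
  show "cyclic_aut m a \<in> hom (integer_mod_group m) (integer_mod_group m)"
    by (auto simp: hom_def cyclic_aut_def mod_simps algebra_simps)
  obtain b where ab: "\<And>x. (a * b * x) mod int m = x mod int m"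
    using inverse_mod_exists[OF assms] by blast
  have "(b * (a * x)) mod int m = x mod int m" "(a * (b * x)) mod int m = x mod int m" for x
    using ab[of x] by (simp_all add: ac_simps)
  then show "bij_betw (cyclic_aut m a) (carrier (integer_mod_group m)) (carrier (integer_mod_group m))"
    by (intro bij_betw_byWitness[where f' = "\<lambda>x. (b * x) mod int m"])
       (auto simp: cyclic_aut_def mod_simps)
qed

lemma dihedral_aut_iso:
  assumes "coprime c (int n)"
  shows "dihedral_aut n c d \<in> iso (dihedral_group n) (dihedral_group n)"
proof (rule isoI)
  show "dihedral_aut n c d \<in> hom (dihedral_group n) (dihedral_group n)"
    by (auto simp: hom_def dihedral_aut_def dihedral_group_def mod_simps algebra_simps mod_add_mult_right_eq)
       (simp_all add: mod_add_right_eq flip: add.assoc)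
  obtain b where cb: "\<And>x. (c * b * x) mod int n = x mod int n"
    using inverse_mod_exists[OF assms] by blast
  have 1: "(b * (c * x)) mod int n = x mod int n" "(c * (b * x)) mod int n = x mod int n" for x
    using cb[of x] by (simp_all add: ac_simps)
  have 2: "(b * ((c * x + d) mod int n - d)) mod int n = x mod int n" for x
    by (metis 1(1) add_diff_cancel_right' mod_diff_left_eq mod_mult_right_eq)
  have 3: "(c * ((b * (x - d)) mod int n) + d) mod int n = x mod int n" for x
    by (metis 1(2) diff_add_cancel mod_add_left_eq mod_mult_right_eq)
  show "bij_betw (dihedral_aut n c d) (carrier (dihedral_group n)) (carrier (dihedral_group n))"
    by (rule bij_betw_byWitness[where f' = "\<lambda>(e, i). (e, (b * (i - int e * d)) mod int n)"])
       (auto simp: dihedral_aut_def dihedral_group_def 1 2 3 mod_simps)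
qed

lemma cyclic_units_reduce:
  assumes "n > 0" and "a \<in> cyclic_units (2 * n)"
  shows "a - \<lfloor>real_of_int a / real n\<rfloor> * int n \<in> cyclic_units n"
proof -
  have "\<lfloor>real_of_int a / real n\<rfloor> = a div int n"
    using floor_divide_of_int_eq[of a "int n"] by simp
  then have "a - \<lfloor>real_of_int a / real n\<rfloor> * int n = a mod int n"
    by (simp add: minus_div_mult_eq_mod)
  moreover have "coprime a (int n)"
    using assms by (simp add: cyclic_units_def)
  ultimately show ?thesis
    using assms(1) by (simp add: cyclic_units_def coprime_mod_left_iff)
qed

end

theory Submission
  imports Defs "HOL-Number_Theory.Cong"
begin

text \<open>
  Both quandles are two copies of \<open>C_n\<close> with the affine operation \<open>i + c (j - i)\<close> on each copy, and
  with a constant added or subtracted when the two points lie in different copies.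

  In \<open>C_2n\<close> the copies are the even and the odd residues: for \<open>x = 2i + \<epsilon>\<close> and \<open>y = 2j + \<delta>\<close>,
  \<open>x + (2k + 1)(y - x) = 2 (i + (2k + 1)(j - i) + k (\<delta> - \<epsilon>)) + \<delta>\<close>,
  so the constant is \<open>k\<close> (\<open>cyclic_quandle_twisted_double\<close>). In \<open>D_n\<close> the copies are the rotations
  and the reflections. After the sign change \<open>\<tau>\<sigma>\<^sup>i \<mapsto> \<tau>\<sigma>\<^sup>j\<close>, \<open>j = -i\<close>, of the reflections, the
  operation of \<open>\<phi>_{c,d}\<close> has the same shape, with constant \<open>-d\<close>
  (\<open>twisted_double_dihedral_quandle\<close>).

  Multiplying both copies by a unit \<open>u\<close> modulo \<open>n\<close> commutes with the affine part and multiplies the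
  constant by \<open>u\<close> (\<open>twisted_double_rescale\<close>). Since \<open>k\<close> and \<open>gcd k n\<close> generate the same subgroup of
  \<open>C_n\<close>, they differ by a unit (\<open>gcd_unit_multiple\<close>), and with its negative the constant \<open>k\<close>
  becomes \<open>- gcd k n\<close>.
\<close>

text \<open>
  With \<open>t\<close> the product of the primes dividing \<open>n\<close> but not
  \<open>u\<close>, every prime divisor of \<open>n\<close> divides exactly one of \<open>u\<close> and \<open>t * m\<close>, hence not their sum.
\<close>
lemma unit_lift:
  fixes u m n :: int
  assumes "coprime u m" and "n \<noteq> 0"
  obtains t where "coprime (u + t * m) n"
proof -
  define A where "A = {p \<in> prime_factors n. \<not> p dvd u}"
  have A: "finite A" "\<And>p. p \<in> A \<Longrightarrow> prime p \<and> \<not> p dvd u"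
    by (auto simp: A_def)
  have "coprime (u + \<Prod>A * m) n"
  proof (rule ccontr)
    assume "\<not> coprime (u + \<Prod>A * m) n"
    then obtain c where c: "c dvd u + \<Prod>A * m" "c dvd n" "\<not> is_unit c"
      by (rule not_coprimeE)
    then have "c \<noteq> 0"
      using assms(2) by auto
    then obtain p where "prime p" "p dvd c"
      using prime_divisor_exists c(3) by blast
    with c have p: "prime p" "p dvd u + \<Prod>A * m" "p dvd n"
      by (auto intro: dvd_trans)
    show False
    proof (cases "p dvd u")
      case True
      then have "\<not> p dvd m"
        using assms(1) p(1) by (meson coprime_common_divisor not_prime_unit)
      then have "p dvd \<Prod>A"
        using True p by (simp add: dvd_add_right_iff prime_dvd_mult_iff)
      then obtain q where "q \<in> A" "p dvd q"
        using A(1) p(1) by (auto simp: prime_dvd_prod_iff)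
      then show False
        using A(2)[of q] p(1) True primes_dvd_imp_eq by blast
    next
      case False
      then have "p \<in> A"
        using p assms(2) by (auto simp: A_def in_prime_factors_iff)
      then have "p dvd \<Prod>A"
        using A(1) dvd_prodI[of A p "\<lambda>x. x"] by simp
      then show False
        using p(2) False by (simp add: dvd_add_left_iff)
    qed
  qed
  then show thesis
    by (rule that)
qed

text \<open>
  With \<open>g = gcd k n\<close>, every inverse of \<open>k div g\<close> modulo \<open>n div g\<close> satisfies the congruence. It need not
  be a unit modulo \<open>n\<close>, but adding a suitable multiple of \<open>n div g\<close> makes it one.
\<close>
lemma gcd_unit_multiple:
  fixes k n :: int
  assumes "n \<noteq> 0"
  obtains u where "coprime u n" and "[u * k = gcd k n] (mod n)"
proof -
  define g where "g = gcd k n"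
  define k' n' where "k' = k div g" and "n' = n div g"
  have kn: "k = g * k'" "n = g * n'" "coprime k' n'"
    using assms by (simp_all add: g_def k'_def n'_def div_gcd_coprime)
  obtain v where v: "[k' * v = 1] (mod n')"
    using cong_solve_coprime_int[OF kn(3)] by blast
  then have "coprime v n'"
    by (metis coprime_iff_invertible_int mult.commute)
  then obtain t where t: "coprime (v + t * n') n"
    using unit_lift assms by blast
  have "(v + t * n') * k' = k' * v + (t * k') * n'"
    by (simp add: algebra_simps)
  then have "[(v + t * n') * k' = 1] (mod n')"
    using v by (simp add: cong_def)
  then have "[g * ((v + t * n') * k') = g * 1] (mod g * n')"
    by (rule cong_cmult_leftI)
  then have "[(v + t * n') * k = gcd k n] (mod n)"
    by (metis g_def kn(1,2) mult.left_commute mult.right_neutral)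
  with t show thesis
    by (rule that)
qed

lemma quandle_isomorphicI:
  assumes "bij_betw f (carrier Q) (carrier Q')"
    and "\<And>x y. x \<in> carrier Q \<Longrightarrow> y \<in> carrier Q \<Longrightarrow> f (qsym Q x y) = qsym Q' (f x) (f y)"
  shows "quandle_isomorphic Q Q'"
proof -
  have "f \<in> quandle_iso Q Q'"
    unfolding quandle_iso_def using assms by blast
  then show ?thesis
    unfolding quandle_isomorphic_def by blast
qed

lemma quandle_isomorphic_trans:
  assumes "quandle_isomorphic P Q" and "quandle_isomorphic Q R"
  shows "quandle_isomorphic P R"
proof -
  obtain f h where f: "f \<in> quandle_iso P Q" and h: "h \<in> quandle_iso Q R"
    using assms by (auto simp: quandle_isomorphic_def)
  show ?thesis
  proof (rule quandle_isomorphicI)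
    show "bij_betw (h \<circ> f) (carrier P) (carrier R)"
      using f h by (auto simp: quandle_iso_def intro: bij_betw_trans)
    show "(h \<circ> f) (qsym P x y) = qsym R ((h \<circ> f) x) ((h \<circ> f) y)"
      if "x \<in> carrier P" "y \<in> carrier P" for x y
      using f h that bij_betwE by (fastforce simp: quandle_iso_def)
  qed
qed

text \<open>
  The common normal form. The difference \<open>\<delta> - \<epsilon>\<close> is taken in the integers, so that a passage from
  copy 0 to copy 1 adds \<open>s\<close> and the opposite passage subtracts it.
\<close>
definition twisted_double :: "nat \<Rightarrow> int \<Rightarrow> int \<Rightarrow> (nat \<times> int) quandle_struct" where
  "twisted_double n c s =
     \<lparr>carrier = {0, 1} \<times> carrier (integer_mod_group n),
      qsym = (\<lambda>(\<epsilon>, i) (\<delta>, j). (\<delta>, (i + c * (j - i) + s * (int \<delta> - int \<epsilon>)) mod int n))\<rparr>"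

lemma twisted_double_mod: "twisted_double n (c mod int n) s = twisted_double n c s"
proof -
  have "(i + (c mod int n) * j + k) mod int n = (i + c * j + k) mod int n" for i j k
    unfolding cong_def[symmetric] by (intro cong_add cong_mult) simp_all
  then show ?thesis
    by (simp add: twisted_double_def)
qed

text \<open>
  Multiplication by \<open>u\<close> is linear, so it respects the affine part and turns the constant \<open>s\<close> into
  \<open>u * s\<close>.
\<close>
lemma twisted_double_rescale:
  assumes "coprime u (int n)" and "[u * s = t] (mod int n)"
  shows "quandle_isomorphic (twisted_double n c s) (twisted_double n c t)"
proof (rule quandle_isomorphicI)
  let ?f = "\<lambda>(\<epsilon>::nat, i). (\<epsilon>, (u * i) mod int n)"
  obtain b where b: "\<And>x. (u * b * x) mod int n = x mod int n"
    using inverse_mod_exists[OF assms(1)] by blast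
  have "(b * (u * x)) mod int n = x mod int n" "(u * (b * x)) mod int n = x mod int n" for x
    using b[of x] by (simp_all add: ac_simps)
  then show "bij_betw ?f (carrier (twisted_double n c s)) (carrier (twisted_double n c t))"
    by (intro bij_betw_byWitness[where f' = "\<lambda>(\<epsilon>, i). (\<epsilon>, (b * i) mod int n)"])
       (auto simp: twisted_double_def mod_simps)
  show "?f (qsym (twisted_double n c s) x y) = qsym (twisted_double n c t) (?f x) (?f y)" for x y
  proof -
    have "[u * ((i + c * (j - i) + s * e) mod int n)
        = (u * i) mod int n + c * ((u * j) mod int n - (u * i) mod int n) + t * e] (mod int n)" for i j e
    proof -
      have "[u * ((i + c * (j - i) + s * e) mod int n) = u * (i + c * (j - i) + s * e)] (mod int n)"
        by (simp add: cong_def mod_simps)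
      also have "u * (i + c * (j - i) + s * e) = u * i + c * (u * j - u * i) + (u * s) * e"
        by (simp add: algebra_simps)
      also have "[\<dots> = (u * i) mod int n + c * ((u * j) mod int n - (u * i) mod int n) + t * e] (mod int n)"
        by (intro cong_add cong_mult cong_diff assms(2)) (simp_all add: cong_def)
      finally show ?thesis .
    qed
    then show ?thesis
      by (auto simp: twisted_double_def cong_def split: prod.splits)
  qed
qed

text \<open>
  The constant \<open>k\<close> is the carry: \<open>(2k + 1)(\<delta> - \<epsilon>)\<close> is \<open>\<delta> - \<epsilon>\<close>, which corrects the parity, plus twice
  \<open>k (\<delta> - \<epsilon>)\<close>.
\<close>
lemma cyclic_quandle_twisted_double:
  assumes "n > 0"
  shows "quandle_isomorphic
    (gen_alexander_quandle (integer_mod_group (2 * n)) (cyclic_aut (2 * n) (2 * k + 1)))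
    (twisted_double n (2 * k + 1) k)" (is "quandle_isomorphic ?Q ?T")
proof (rule quandle_isomorphicI)
  let ?f = "\<lambda>x. (nat (x mod 2), x div 2)"
  show "bij_betw ?f (carrier ?Q) (carrier ?T)"
    using assms
    by (intro bij_betw_byWitness[where f' = "\<lambda>(\<epsilon>, i). 2 * i + int \<epsilon>"])
       (auto simp: gen_alexander_quandle_def twisted_double_def carrier_integer_mod_group)
  show "?f (qsym ?Q x y) = qsym ?T (?f x) (?f y)" if "x \<in> carrier ?Q" "y \<in> carrier ?Q" for x y
  proof -
    define e i d j where defs: "e = x mod 2" "i = x div 2" "d = y mod 2" "j = y div 2"
    have xy: "x = 2 * i + e" "y = 2 * j + d" and d: "0 \<le> e" "e < 2" "0 \<le> d" "d < 2"
      by (simp_all add: defs)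
    let ?z = "i + (2 * k + 1) * (j - i) + k * (d - e)"
    have "[x + (2 * k + 1) * (- x mod (2 * int n) + y) = x + (2 * k + 1) * (- x + y)] (mod 2 * int n)"
      by (intro cong_add cong_mult cong_refl) simp
    then have "qsym ?Q x y = (x + (2 * k + 1) * (y - x)) mod (2 * int n)"
      using that by (simp add: gen_alexander_quandle_def cyclic_aut_def cong_def mod_add_right_eq mod_add_mult_right_eq)
    also have "x + (2 * k + 1) * (y - x) = 2 * ?z + d"
      by (simp add: xy algebra_simps)
    also have "(2 * ?z + d) mod (2 * int n) = 2 * (?z mod int n) + d"
    proof -
      have "(2 * w + d) div 2 = w" "(2 * w + d) mod 2 = d" for w
        using d by auto
      then show ?thesis
        using zmod_zmult2_eq[of "int n" "2 * ?z + d" 2] by (simp only: of_nat_0_le_iff simp_thms)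
    qed
    finally have "qsym ?Q x y = 2 * (?z mod int n) + d" .
    then show ?thesis
      using d by (simp add: twisted_double_def flip: defs)
  qed
qed

lemma dihedral_inv:
  assumes "(\<epsilon>, i) \<in> carrier (dihedral_group n)"
  shows "inv\<^bsub>dihedral_group n\<^esub> (\<epsilon>, i) = (\<epsilon>, (if \<epsilon> = 0 then - i else i) mod int n)"
proof (rule group.inv_equality[OF group_dihedral_group])
  show "(\<epsilon>, (if \<epsilon> = 0 then - i else i) mod int n) \<in> carrier (dihedral_group n)"
    using assms by (simp add: dihedral_group_def)
  show "(\<epsilon>, (if \<epsilon> = 0 then - i else i) mod int n) \<otimes>\<^bsub>dihedral_group n\<^esub> (\<epsilon>, i) = \<one>\<^bsub>dihedral_group n\<^esub>"
    using assms by (auto simp: dihedral_group_def mod_add_left_eq mod_add_right_eq)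
qed (rule assms)

text \<open>
  The quotient of \<open>(\<epsilon>, i)\<close> and \<open>(\<delta>, j)\<close> is a reflection exactly when \<open>\<epsilon> \<noteq> \<delta>\<close>. Only then do the
  translation by \<open>d\<close> and the inversion of rotations, the sign \<open>s\<close>, take effect.
\<close>
lemma dihedral_quandle_op:
  fixes c d :: int
  assumes "(\<epsilon>, i) \<in> carrier (dihedral_group n)" and "(\<delta>, j) \<in> carrier (dihedral_group n)"
  defines "s \<equiv> (-1) ^ (\<epsilon> + \<delta>)"
  shows "qsym (gen_alexander_quandle (dihedral_group n) (dihedral_aut n c d)) (\<epsilon>, i) (\<delta>, j)
    = (\<delta>, (s * i + c * (j - s * i) + (if \<epsilon> = \<delta> then 0 else d)) mod int n)"
proof -
  \<comment> \<open>\<open>(\<epsilon>, i')\<close> is the inverse of \<open>(\<epsilon>, i)\<close>, and \<open>p\<close> is the parity of its product with \<open>(\<delta>, j)\<close>.\<close>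
  define i' p where "i' = (if \<epsilon> = 0 then - i else i)" and "p = (\<epsilon> + \<delta>) mod 2"
  have \<epsilon>\<delta>: "\<epsilon> \<in> {0, 1}" "\<delta> \<in> {0, 1}"
    using assms(1,2) by (simp_all add: dihedral_group_def)
  have "qsym (gen_alexander_quandle (dihedral_group n) (dihedral_aut n c d)) (\<epsilon>, i) (\<delta>, j)
      = ((\<epsilon> + p) mod 2, ((-1) ^ p * i
          + (c * (((-1) ^ \<delta> * (i' mod int n) + j) mod int n) + int p * d) mod int n) mod int n)"
    unfolding gen_alexander_quandle_def quandle_struct.simps dihedral_inv[OF assms(1)] i'_def p_def
    by (simp only: dihedral_group_def dihedral_aut_def monoid.simps prod.case)
  moreover have "[(-1) ^ p * i + (c * (((-1) ^ \<delta> * (i' mod int n) + j) mod int n) + int p * d) mod int n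
      = (-1) ^ p * i + (c * ((-1) ^ \<delta> * i' + j) + int p * d)] (mod int n)"
    by (intro cong_add cong_mult cong_mod_leftI cong_refl)
  moreover have "(-1) ^ p * i + (c * ((-1) ^ \<delta> * i' + j) + int p * d)
      = s * i + c * (j - s * i) + (if \<epsilon> = \<delta> then 0 else d)"
    using \<epsilon>\<delta> by (auto simp: s_def i'_def p_def algebra_simps)
  moreover have "(\<epsilon> + p) mod 2 = \<delta>"
    using \<epsilon>\<delta> by (auto simp: p_def)
  ultimately show ?thesis
    by (simp only: cong_def)
qed

text \<open>
  Negating the exponents of the reflections removes the sign \<open>s\<close> from the operation of the dihedral
  quandle. It also negates results that are reflections, so \<open>d\<close> is subtracted in copy 1 and added
  in copy 0: the constant is \<open>-d\<close>.
\<close>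
lemma twisted_double_dihedral_quandle:
  "quandle_isomorphic (twisted_double n c (- d))
    (gen_alexander_quandle (dihedral_group n) (dihedral_aut n c d))" (is "quandle_isomorphic ?T ?Q")
proof (rule quandle_isomorphicI)
  let ?f = "\<lambda>(\<epsilon>::nat, i). (\<epsilon>, ((-1) ^ \<epsilon> * i) mod int n)"
  show "bij_betw ?f (carrier ?T) (carrier ?Q)"
    by (intro bij_betw_byWitness[where f' = ?f])
       (auto simp: gen_alexander_quandle_def twisted_double_def dihedral_group_def mod_minus_eq)
  show "?f (qsym ?T x y) = qsym ?Q (?f x) (?f y)" if xy_in: "x \<in> carrier ?T" "y \<in> carrier ?T" for x y
  proof -
    obtain \<epsilon> i \<delta> j where xy: "x = (\<epsilon>, i)" "y = (\<delta>, j)" "\<epsilon> \<in> {0, 1}" "\<delta> \<in> {0, 1}"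
      using xy_in by (auto simp: twisted_double_def)
    define i' j' where "i' = ((-1) ^ \<epsilon> * i) mod int n" and "j' = ((-1) ^ \<delta> * j) mod int n"
    define s :: int where "s = (-1) ^ (\<epsilon> + \<delta>)"
    have f: "?f x = (\<epsilon>, i')" "?f y = (\<delta>, j')"
      by (simp_all only: xy i'_def j'_def prod.case)
    have "(\<epsilon>, i') \<in> carrier (dihedral_group n)" "(\<delta>, j') \<in> carrier (dihedral_group n)"
      using xy by (simp_all add: dihedral_group_def i'_def j'_def)
    note op = dihedral_quandle_op[OF this, of c d, folded s_def]
    have "[(-1) ^ \<delta> * ((i + c * (j - i) - d * (int \<delta> - int \<epsilon>)) mod int n)
        = (-1) ^ \<delta> * (i + c * (j - i) - d * (int \<delta> - int \<epsilon>))] (mod int n)"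
      by (simp add: cong_def mod_mult_right_eq)
    also have "(-1) ^ \<delta> * (i + c * (j - i) - d * (int \<delta> - int \<epsilon>))
        = s * ((-1) ^ \<epsilon> * i) + c * ((-1) ^ \<delta> * j - s * ((-1) ^ \<epsilon> * i)) + (if \<epsilon> = \<delta> then 0 else d)"
      using xy by (auto simp: s_def algebra_simps)
    also have "[\<dots> = s * i' + c * (j' - s * i') + (if \<epsilon> = \<delta> then 0 else d)] (mod int n)"
      unfolding i'_def j'_def by (intro cong_add cong_mult cong_diff) (simp_all add: cong_def)
    finally show ?thesis
      unfolding f op by (simp add: xy twisted_double_def cong_def)
  qed
qed

theorem corollary1p7:
  fixes n k :: nat and a :: int
  assumes "n > 0"
    and "a \<in> cyclic_units (2 * n)"
    and "a = 2 * int k + 1"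
  shows "quandle_isomorphic
           (gen_alexander_quandle (integer_mod_group (2 * n)) (cyclic_aut (2 * n) a))
           (gen_alexander_quandle (dihedral_group n)
              (dihedral_aut n (a - \<lfloor>real_of_int a / real n\<rfloor> * int n) (int (gcd k n))))"
proof -
  let ?g = "int (gcd k n)"
  have "\<lfloor>real_of_int a / real n\<rfloor> = a div int n"
    using floor_divide_of_int_eq[of a "int n"] by simp
  then have reduce: "a - \<lfloor>real_of_int a / real n\<rfloor> * int n = a mod int n"
    by (simp add: minus_div_mult_eq_mod)
  obtain u where u: "coprime u (int n)" "[u * int k = ?g] (mod int n)"
    using gcd_unit_multiple[of "int n" "int k"] assms(1) by auto
  have "quandle_isomorphic
      (gen_alexander_quandle (integer_mod_group (2 * n)) (cyclic_aut (2 * n) a))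
      (twisted_double n a (int k))"
    using cyclic_quandle_twisted_double[OF assms(1)] assms(3) by simp
  moreover have "quandle_isomorphic (twisted_double n a (int k)) (twisted_double n a (- ?g))"
    using u twisted_double_rescale[of "- u"] by (simp add: cong_minus_minus_iff)
  moreover have "quandle_isomorphic (twisted_double n a (- ?g))
      (gen_alexander_quandle (dihedral_group n) (dihedral_aut n (a mod int n) ?g))"
    using twisted_double_dihedral_quandle[of n "a mod int n" ?g] by (simp add: twisted_double_mod)
  ultimately show ?thesis
    unfolding reduce by (rule quandle_isomorphic_trans[OF quandle_isomorphic_trans])
qed

end
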